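(* Let $n\ge 1$ and let $A_n$ be the one-dimensional Clobber configuration consisting of $n$ stones on $n$ consecutive squares of a single row, with colors alternating black, white, black, white, $\dots$ (starting with a black stone). Then, even if moves are not required to alternate between white and black (i.e., for any sequence of legal moves whatsoever), $A_n$ cannot be reduced to fewer than $\lceil n/4\rceil + [n\equiv 3 \pmod 4]$ stones. Here $[P]$ equals $1$ if $P$ holds and $0$ otherwise.
   Context: Clobber is played with black and white stones occupying some squares of a grid board. A move consists of picking up a stone and moving it onto a horizontally or vertically adjacent square occupied by a stone of the opposite color; that opposite-colored stone is removed and replaced by the moved stone. A configuration is reduced to $k$ stones if a sequence of moves ends in a configuration with exactly $k$ stones, none of which can move (no stone is horizontally or vertically adjacent to a stone of the opposite color). *)

theory Defs
  imports Complex_Main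
begin

datatype stone = Black | White

text \<open>
  A configuration assigns to each square of the unbounded grid its stone, if any.  Stones only
  ever move onto occupied squares, so the shape of the board around the stones plays no role.
\<close>

type_synonym square = "int \<times> int"
type_synonym config = "square \<Rightarrow> stone option"

definition adjacent :: "square \<Rightarrow> square \<Rightarrow> bool" where
  "adjacent p q \<longleftrightarrow> \<bar>fst p - fst q\<bar> + \<bar>snd p - snd q\<bar> = 1"

text \<open>The stone on \<open>p\<close> clobbers the stone on \<open>q\<close>; either colour may move at any time.\<close>

inductive clobber_move :: "config \<Rightarrow> config \<Rightarrow> bool" where
  "\<lbrakk>C p = Some a; C q = Some b; a \<noteq> b; adjacent p q\<rbrakk>
     \<Longrightarrow> clobber_move C (C(p := None, q := Some a))"

definition immobile :: "config \<Rightarrow> bool" where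
  "immobile C \<longleftrightarrow>
     \<not> (\<exists>p q a b. C p = Some a \<and> C q = Some b \<and> a \<noteq> b \<and> adjacent p q)"

definition reducible_to :: "config \<Rightarrow> nat \<Rightarrow> bool" where
  "reducible_to C k \<longleftrightarrow>
     (\<exists>D. clobber_move\<^sup>*\<^sup>* C D \<and> finite (dom D) \<and> card (dom D) = k \<and> immobile D)"

definition alternating_row :: "nat \<Rightarrow> config" where
  "alternating_row n = (\<lambda>(x, y).
     if y = 0 \<and> 0 \<le> x \<and> x < int n then Some (if even x then Black else White) else None)"

end

theory Submission
  imports Defs
begin

text \<open>
  Starting from an alternating row, every maximal run of stones stays alternating except that
  the outermost pair at either end may be monochromatic.  Give a run of \<open>n\<close> stones with \<open>e\<close>
  monochromatic neighbouring pairs the weight \<open>m = n + e\<close>.  A move splits a run into two runs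
  whose weights sum to \<open>m\<close>, apart from boundary cases in which one part has weight at most 2.
  The function \<open>\<lceil>m/4\<rceil> + [m \<equiv> 3 (mod 4)]\<close> is subadditive and also copes
  with the boundary cases, so its sum over the runs never decreases, while in an
  immobile position it is at most the number of stones.
\<close>

section \<open>Arithmetic of the bound\<close>

definition stone_bound :: "int \<Rightarrow> int" where
  "stone_bound m = (m + 3) div 4 + of_bool (m mod 4 = 3)"

text \<open>For \<open>m = 4 * q + r\<close> the bound is \<open>q\<close> plus 0, 1, 1, 2 according
  to \<open>r\<close> = 0, 1, 2, 3, so sixteen pairs of residues settle the claim.\<close>

lemma stone_bound_add: "stone_bound (a + b) \<le> stone_bound a + stone_bound b"
proof -
  define q r where "q = a div 4" and "r = a mod 4"
  define s t where "s = b div 4" and "t = b mod 4"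
  have ab: "a = 4 * q + r" "b = 4 * s + t" by (simp_all add: q_def r_def s_def t_def)
  have "r \<in> {0..<4}" "t \<in> {0..<4}" by (auto simp: r_def t_def)
  moreover have "{0..<4} = {0, 1, 2, 3 :: int}" by auto
  ultimately have "r = 0 \<or> r = 1 \<or> r = 2 \<or> r = 3" "t = 0 \<or> t = 1 \<or> t = 2 \<or> t = 3" by auto
  then show ?thesis
    unfolding stone_bound_def ab by (elim disjE) (simp_all, presburger+)
qed

text \<open>Serves moves that leave a single stone, of bound 1, on one side and weight
  \<open>m - 2\<close> on the other.\<close>

lemma stone_bound_diff_2: "stone_bound m \<le> stone_bound (m - 2) + 1"
  unfolding stone_bound_def of_bool_def by (simp split: if_splits; presburger)

text \<open>Serves moves that strike a monochromatic end pair: two alternating stones, of bound 1,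
  split off and weight \<open>m - 4\<close> remains.\<close>

lemma stone_bound_diff_4: "stone_bound m = stone_bound (m - 4) + 1"
  unfolding stone_bound_def of_bool_def by (simp split: if_splits; presburger)

text \<open>The interval is half-open and may be empty, so a move by an outermost stone still yields
  two runs.\<close>

definition near_alternating_run :: "(int \<Rightarrow> stone option) \<Rightarrow> int \<Rightarrow> int \<Rightarrow> bool" where
  "near_alternating_run c l r \<longleftrightarrow> l \<le> r \<and> c (l - 1) = None \<and> c r = None \<and>
     (\<forall>x. l \<le> x \<and> x < r \<longrightarrow> c x \<noteq> None) \<and>
     (\<forall>x. l < x \<and> x + 2 < r \<longrightarrow> c x \<noteq> c (x + 1))"

text \<open>The guard \<open>l + 2 < r\<close> keeps the only pair of a two-stone run from being counted twice.\<close>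

definition run_weight :: "(int \<Rightarrow> stone option) \<Rightarrow> int \<Rightarrow> int \<Rightarrow> int" where
  "run_weight c l r = r - l + of_bool (l + 1 < r \<and> c l = c (l + 1))
     + of_bool (l + 2 < r \<and> c (r - 2) = c (r - 1))"

section \<open>Splitting a run by a move to the right\<close>

lemma stone_eqI: "a \<noteq> b \<Longrightarrow> c \<noteq> b \<Longrightarrow> a = (c :: stone)"
  by (cases a; cases b; cases c) auto

text \<open>The vacated square \<open>p\<close> separates the two runs. Besides the lost stone, only
  pairs meeting \<open>p\<close> or \<open>p + 1\<close> can change the weight.\<close>

lemma clobber_right_runs:
  assumes run: "near_alternating_run c l r" and p: "l \<le> p" "p + 1 < r"
    and ab: "c p = Some a" "c (p + 1) = Some b" "a \<noteq> b"
  defines "c' \<equiv> c(p := None, p + 1 := Some a)"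
  shows "near_alternating_run c' l p" "near_alternating_run c' (p + 1) r"
    and "stone_bound (run_weight c l r)
           \<le> stone_bound (run_weight c' l p) + stone_bound (run_weight c' (p + 1) r)"
proof -
  have ends: "c (l - 1) = None" "c r = None"
    and occ: "\<And>x. l \<le> x \<Longrightarrow> x < r \<Longrightarrow> c x \<noteq> None"
    and alt: "\<And>x. l < x \<Longrightarrow> x + 2 < r \<Longrightarrow> c x \<noteq> c (x + 1)"
    using run by (auto simp: near_alternating_run_def)
  show "near_alternating_run c' l p"
    using p by (simp add: near_alternating_run_def c'_def ends occ alt)
  show "near_alternating_run c' (p + 1) r"
    using p by (simp add: near_alternating_run_def c'_def ends occ alt del: not_None_eq)
  \<comment> \<open>With only two colours, replacing \<open>b\<close> by \<open>a\<close> toggles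
    whether the pair \<open>p + 1\<close>, \<open>p + 2\<close> is monochromatic.\<close>
  have flip: "c' (p + 1) = c' (p + 2) \<longleftrightarrow> c (p + 1) \<noteq> c (p + 2)" if "p + 2 < r"
  proof -
    have "c (p + 2) \<noteq> None" using occ[of "p + 2"] p that by auto
    then obtain d where "c (p + 2) = Some d" by auto
    then show ?thesis using ab stone_eqI[of a b d] by (auto simp: c'_def)
  qed
  \<comment> \<open>The pair \<open>p - 2\<close>, \<open>p - 1\<close> was inner in the old run,
    hence alternating, unless it is the first pair, which is counted already.\<close>
  have left: "run_weight c' l p = p - l + of_bool (l + 1 < p \<and> c l = c (l + 1))"
    using alt[of "p - 2"] p by (auto simp: run_weight_def c'_def)
  have right: "run_weight c' (p + 1) r = r - p - 1 + of_bool (p + 2 < r \<and> c (p + 1) \<noteq> c (p + 2))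
      + of_bool (p + 3 < r \<and> c (r - 2) = c (r - 1))"
  proof -
    have "r = p + 2 \<or> r = p + 3 \<or> p + 3 < r" using p by auto
    then show ?thesis using flip unfolding run_weight_def
      by (elim disjE) (simp_all add: c'_def add.commute[of 2 p])
  qed
  \<comment> \<open>The end pairs of the old run are sorted by their position relative to the move;
    the pair \<open>p\<close>, \<open>p + 1\<close> never counts, its colours being
    different.\<close>
  have whole: "run_weight c l r = r - l + of_bool (l + 1 < p \<and> c l = c (l + 1)) +
      of_bool (l + 1 = p \<and> c l = c (l + 1)) +
      of_bool (p + 3 = r \<and> c (p + 1) = c (p + 2)) + of_bool (p + 3 < r \<and> c (r - 2) = c (r - 1))"
  proof -
    have "r = p + 2 \<or> r = p + 3 \<or> p + 3 < r" "l = p \<or> l + 1 = p \<or> l + 1 < p" using p by auto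
    then show ?thesis using ab p unfolding run_weight_def
      by (elim disjE) (simp_all add: add.commute[of 1 p] add.commute[of 2 p])
  qed
  \<comment> \<open>The pair \<open>p + 1\<close>, \<open>p + 2\<close> is absent, monochromatic
    (possible only as the last pair), or alternating.\<close>
  consider "r = p + 2" | "r = p + 3" "c (p + 1) = c (p + 2)"
    | "p + 2 < r" "c (p + 1) \<noteq> c (p + 2)"
  proof -
    have "c (p + 1) \<noteq> c (p + 2)" if "p + 3 < r"
      using alt[of "p + 1"] p that by (simp add: add.commute[of 2 p])
    moreover have "r = p + 2 \<or> r = p + 3 \<or> p + 3 < r" using p by auto
    ultimately show thesis using that by force
  qed
  then show "stone_bound (run_weight c l r)
      \<le> stone_bound (run_weight c' l p) + stone_bound (run_weight c' (p + 1) r)"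
  proof cases
    case 1
    show ?thesis
    \<comment> \<open>Here and in the other two cases, the exception is a monochromatic first pair
      \<open>p - 1\<close>, \<open>p\<close>: the move breaks it and leaves one stone on the
      left.\<close>
    proof (cases "l + 1 = p \<and> c l = c (l + 1)")
      case True
      then have "run_weight c l r = 4" "run_weight c' l p = 1" "run_weight c' (p + 1) r = 1"
        unfolding left right whole using 1 by auto
      then show ?thesis by (simp add: stone_bound_def)
    next
      case False
      then have "run_weight c' l p = run_weight c l r - 2" "run_weight c' (p + 1) r = 1"
        unfolding left right whole using 1 by auto
      then show ?thesis using stone_bound_diff_2[of "run_weight c l r"] by (simp add: stone_bound_def)
    qed
  next
    case 2
    show ?thesis
    proof (cases "l + 1 = p \<and> c l = c (l + 1)")
      case True
      then have "run_weight c l r = 6" "run_weight c' l p = 1" "run_weight c' (p + 1) r = 2"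
        unfolding left right whole using 2 by auto
      then show ?thesis by (simp add: stone_bound_def)
    next
      case False
      then have "run_weight c' l p = run_weight c l r - 4" "run_weight c' (p + 1) r = 2"
        unfolding left right whole using 2 by auto
      then show ?thesis using stone_bound_diff_4[of "run_weight c l r"] by (simp add: stone_bound_def)
    qed
  next
    case 3
    show ?thesis
    proof (cases "l + 1 = p \<and> c l = c (l + 1)")
      case True
      then have "run_weight c' l p = 1" "run_weight c' (p + 1) r = run_weight c l r - 2"
        unfolding left right whole using 3 by auto
      then show ?thesis using stone_bound_diff_2[of "run_weight c l r"] by (simp add: stone_bound_def)
    next
      case False
      \<comment> \<open>The new monochromatic pair at the left end of the right part makes up for
        the lost stone.\<close>
      then have "run_weight c l r = run_weight c' l p + run_weight c' (p + 1) r"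
        unfolding left right whole using 3 by auto
      then show ?thesis using stone_bound_add by simp
    qed
  qed
qed

section \<open>Reflection and moves to the left\<close>

lemma near_alternating_run_reflect:
  "near_alternating_run (\<lambda>x. c (- x)) (1 - r) (1 - l) \<longleftrightarrow> near_alternating_run c l r"
proof -
  have "near_alternating_run (\<lambda>x. c (- x)) (1 - r) (1 - l)"
    if run: "near_alternating_run c l r" for c l r
  proof -
    have "c (- x) \<noteq> c (- x - 1)" if "1 - r < x" "x + 2 < 1 - l" for x
    proof -
      have "l < - x - 1" "(- x - 1) + 2 < r" using that by auto
      then have "c (- x - 1) \<noteq> c ((- x - 1) + 1)"
        using run unfolding near_alternating_run_def by blast
      then show ?thesis by simp
    qed
    then show ?thesis using run by (auto simp: near_alternating_run_def)
  qed
  \<comment> \<open>Reflecting twice restores \<open>c\<close>, \<open>l\<close> and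
    \<open>r\<close>, which gives the converse.\<close>
  from this[of c l r] this[of "\<lambda>x. c (- x)" "1 - r" "1 - l"] show ?thesis by auto
qed

text \<open>The two end pairs trade places; in a two-stone run the only pair is its own mirror
  image, so the asymmetric guard does no harm.\<close>

lemma run_weight_reflect: "run_weight (\<lambda>x. c (- x)) (1 - r) (1 - l) = run_weight c l r"
proof -
  have "r < l + 2 \<or> r = l + 2 \<or> l + 2 < r" by auto
  then show ?thesis
    unfolding run_weight_def by (elim disjE) (auto simp: algebra_simps eq_commute)
qed

lemma clobber_left_runs:
  assumes run: "near_alternating_run c l r" and p: "l < p" "p < r"
    and ab: "c p = Some a" "c (p - 1) = Some b" "a \<noteq> b"
  defines "c' \<equiv> c(p := None, p - 1 := Some a)"
  shows "near_alternating_run c' l p" "near_alternating_run c' (p + 1) r"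
    and "stone_bound (run_weight c l r)
           \<le> stone_bound (run_weight c' l p) + stone_bound (run_weight c' (p + 1) r)"
proof -
  define d where "d = (\<lambda>x. c (- x))"
  have d': "d(- p := None, - p + 1 := Some a) = (\<lambda>x. c' (- x))"
    by (auto simp: d_def c'_def fun_eq_iff)
  have run_d: "near_alternating_run d (1 - r) (1 - l)"
    using run by (simp add: d_def near_alternating_run_reflect)
  have ab_d: "d (- p) = Some a" "d (- p + 1) = Some b"
    using ab by (simp_all add: d_def)
  have p_d: "1 - r \<le> - p" "- p + 1 < 1 - l" using p by auto
  \<comment> \<open>Reflection swaps the parts: the left part for \<open>d\<close> mirrors the right
    part for \<open>c'\<close>, and conversely.\<close>
  note split = clobber_right_runs[OF run_d p_d ab_d ab(3), unfolded d']
  show "near_alternating_run c' l p" "near_alternating_run c' (p + 1) r"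
    using split(1,2) near_alternating_run_reflect[of c' p l] near_alternating_run_reflect[of c' r "p + 1"]
    by (simp_all add: add.commute)
  show "stone_bound (run_weight c l r)
      \<le> stone_bound (run_weight c' l p) + stone_bound (run_weight c' (p + 1) r)"
    using split(3) run_weight_reflect[of c' p l] run_weight_reflect[of c' r "p + 1"]
      run_weight_reflect[of c r l]
    by (simp add: d_def add.commute)
qed

section \<open>Following the runs to the final position\<close>

definition row :: "config \<Rightarrow> int \<Rightarrow> stone option" where
  "row C x = C (x, 0)"

definition survivors :: "config \<Rightarrow> int \<Rightarrow> int \<Rightarrow> int" where
  "survivors D l r = int (card ({l..<r} \<inter> dom (row D)))"

lemma survivors_split:
  assumes "l \<le> p" "p < r"
  shows "survivors D l p + survivors D (p + 1) r \<le> survivors D l r"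
proof -
  have "card ({l..<p} \<inter> dom (row D)) + card ({p + 1..<r} \<inter> dom (row D))
      = card ({l..<p} \<inter> dom (row D) \<union> {p + 1..<r} \<inter> dom (row D))"
    by (rule card_Un_disjoint[symmetric]) auto
  also have "\<dots> \<le> card ({l..<r} \<inter> dom (row D))"
    using assms by (intro card_mono) auto
  finally show ?thesis by (simp add: survivors_def)
qed

lemma immobile_row_eq:
  assumes "immobile D" "row D x \<noteq> None" "row D (x + 1) \<noteq> None"
  shows "row D x = row D (x + 1)"
proof -
  obtain a b where ab: "D (x, 0) = Some a" "D (x + 1, 0) = Some b"
    using assms(2,3) by (auto simp: row_def)
  have "adjacent (x, 0) (x + 1, 0)" by (simp add: adjacent_def)
  then have "a = b" using assms(1) ab unfolding immobile_def by blast
  then show ?thesis using ab by (simp add: row_def)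
qed

text \<open>Inner pairs alternate, yet immobility makes all pairs monochromatic; so there is no
  inner pair and at most three stones.\<close>

lemma stone_bound_le_survivors_immobile:
  assumes im: "immobile D" and run: "near_alternating_run (row D) l r"
  shows "stone_bound (run_weight (row D) l r) \<le> survivors D l r"
proof -
  have occ: "\<And>x. l \<le> x \<Longrightarrow> x < r \<Longrightarrow> row D x \<noteq> None" and "l \<le> r"
    using run by (auto simp: near_alternating_run_def)
  have eq: "row D x = row D (x + 1)" if "l \<le> x" "x + 1 < r" for x
    using immobile_row_eq[OF im] occ that by simp
  have "{l..<r} \<inter> dom (row D) = {l..<r}" using occ by auto
  then have surv: "survivors D l r = r - l" using \<open>l \<le> r\<close> by (simp add: survivors_def)
  have "r \<le> l + 3"
  proof (rule ccontr)
    assume "\<not> r \<le> l + 3"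
    then have inner: "l < l + 1" "l + 1 + 2 < r" by auto
    then have "row D (l + 1) \<noteq> row D (l + 1 + 1)"
      using run unfolding near_alternating_run_def by blast
    then show False using eq[of "l + 1"] inner by simp
  qed
  then have "r = l \<or> r = l + 1 \<or> r = l + 2 \<or> r = l + 3" using \<open>l \<le> r\<close> by auto
  \<comment> \<open>Lengths 0, 1, 2, 3 have weights 0, 1, 3, 5 and bounds 0, 1, 2, 2.\<close>
  then show ?thesis unfolding surv
    using eq[of l] eq[of "l + 1"] by (elim disjE) (auto simp: run_weight_def stone_bound_def)
qed

text \<open>Stated for one arbitrary run of any one-row position, so that the induction, which peels
  off the first move, applies to both parts of a split run.\<close>

lemma stone_bound_le_survivors:
  assumes "clobber_move\<^sup>*\<^sup>* C D" and im: "immobile D"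
    and "\<And>x y. y \<noteq> 0 \<Longrightarrow> C (x, y) = None" and "near_alternating_run (row C) l r"
  shows "stone_bound (run_weight (row C) l r) \<le> survivors D l r"
  using assms(1,3,4)
proof (induction arbitrary: l r rule: converse_rtranclp_induct)
  case base
  then show ?case using stone_bound_le_survivors_immobile[OF im] by blast
next
  case (step C C')
  from step.hyps(1) obtain p q a b where pq: "C p = Some a" "C q = Some b" "a \<noteq> b" "adjacent p q"
    and C': "C' = C(p := None, q := Some a)"
    by (cases rule: clobber_move.cases) auto
  obtain x y where p: "p = (x, 0)" and q: "q = (y, 0)"
    using step.prems(1) pq by (metis option.distinct(1) surj_pair)
  have adj: "y = x + 1 \<or> y = x - 1" using pq(4) by (auto simp: adjacent_def p q)
  have stones: "row C x = Some a" "row C y = Some b" using pq by (auto simp: row_def p q)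
  have row': "row C' = (row C)(x := None, y := Some a)"
    by (auto simp: row_def C' p q fun_eq_iff)
  have IH: "stone_bound (run_weight (row C') l r) \<le> survivors D l r"
    if "near_alternating_run (row C') l r" for l r
  proof (rule step.IH[OF _ that])
    show "C' (x, y) = None" if "y \<noteq> 0" for x y
      using step.prems(1) that by (simp add: C' p q)
  qed
  have ends: "row C (l - 1) = None" "row C r = None"
    using step.prems(2) by (auto simp: near_alternating_run_def)
  show ?case
  proof (cases "l \<le> x \<and> x < r")
    case True
    have "y \<noteq> r" "y \<noteq> l - 1" using ends stones by auto
    then have "near_alternating_run (row C') l x \<and> near_alternating_run (row C') (x + 1) r \<and>
        stone_bound (run_weight (row C) l r)
          \<le> stone_bound (run_weight (row C') l x) + stone_bound (run_weight (row C') (x + 1) r)"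
      using adj True clobber_right_runs[OF step.prems(2), of x a b]
        clobber_left_runs[OF step.prems(2), of x a b] stones pq(3)
      by (elim disjE) (auto simp: row')
    then show ?thesis
      using IH[of l x] IH[of "x + 1" r] survivors_split[of l x r D] True by linarith
  next
    case False
    \<comment> \<open>The empty squares \<open>l - 1\<close> and \<open>r\<close> shield the run
      from a move made outside it.\<close>
    have "x \<noteq> r" "x \<noteq> l - 1" "y \<noteq> r" "y \<noteq> l - 1" using ends stones by auto
    then have "\<not> (l - 1 \<le> x \<and> x \<le> r)" "\<not> (l - 1 \<le> y \<and> y \<le> r)"
      using False adj by auto
    then have same: "row C' z = row C z" if "l - 1 \<le> z" "z \<le> r" for z
      using that by (auto simp: row')
    have "near_alternating_run (row C') l r"
      using step.prems(2) by (auto simp: near_alternating_run_def same)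
    moreover have "run_weight (row C') l r = run_weight (row C) l r"
      by (auto simp: run_weight_def same)
    ultimately show ?thesis using IH[of l r] by simp
  qed
qed

section \<open>The alternating row\<close>

lemma ceiling_quarter: "\<lceil>real n / 4\<rceil> = (int n + 3) div 4"
  by (rule ceiling_unique) linarith+

theorem theorem2:
  fixes n :: nat
  assumes "n \<ge> 1"
  shows "\<not> (\<exists>k. int k < \<lceil>real n / 4\<rceil> + of_bool (n mod 4 = 3) \<and> reducible_to (alternating_row n) k)"
proof
  assume "\<exists>k. int k < \<lceil>real n / 4\<rceil> + of_bool (n mod 4 = 3) \<and> reducible_to (alternating_row n) k"
  then obtain D where k: "int (card (dom D)) < \<lceil>real n / 4\<rceil> + of_bool (n mod 4 = 3)"
    and D: "clobber_move\<^sup>*\<^sup>* (alternating_row n) D" "finite (dom D)" "immobile D"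
    by (auto simp: reducible_to_def)
  have run: "near_alternating_run (row (alternating_row n)) 0 (int n)"
    by (auto simp: near_alternating_run_def row_def alternating_row_def)
  have "run_weight (row (alternating_row n)) 0 (int n) = int n"
    by (auto simp: run_weight_def row_def alternating_row_def)
  then have "stone_bound (int n) \<le> survivors D 0 (int n)"
    using stone_bound_le_survivors[OF D(1,3) _ run] by (simp add: alternating_row_def)
  also have "\<dots> \<le> int (card (dom D))"
  proof -
    have "(\<lambda>x. (x, 0)) ` ({0..<int n} \<inter> dom (row D)) \<subseteq> dom D"
      by (auto simp: row_def)
    then show ?thesis
      unfolding survivors_def of_nat_le_iff
      by (rule card_inj_on_le[OF _ _ D(2), rotated]) (simp add: inj_on_def)
  qed
  finally have "stone_bound (int n) \<le> int (card (dom D))" .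
  moreover have "int n mod 4 = 3 \<longleftrightarrow> n mod 4 = 3" by presburger
  ultimately show False using k by (simp add: stone_bound_def ceiling_quarter)
qed

end
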